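(* Let $(X,\|\cdot\|)$ be a Banach space, $J:X\to X$ a nonexpansive mapping, and $\Phi(\lambda,x)=\lambda J\left(\frac{1-\lambda}{\lambda}x\right)$ for $\lambda\in(0,1]$, $x\in X$. Assume there is a constant $C$ such that $$\|\Phi(\lambda,x)-\Phi(\mu,x)\|\le|\lambda-\mu|\,(C+\|x\|)\qquad\forall x\in X,\ \forall(\lambda,\mu)\in(0,1]^2 .$$ Let $\boldsymbol\lambda$ be a $\mathcal C^1$ function from $[0,+\infty)$ to $(0,1]$ such that $\frac{\boldsymbol\lambda'(t)}{\boldsymbol\lambda^2(t)}$ converges to $0$ as $t\to+\infty$, let $u_0\in X$, and let $u$ be the solution on $[0,+\infty)$ of $u(t)+u'(t)=\Phi(\boldsymbol\lambda(t),u(t))$ with $u(0)=u_0$. Then $\|u(t)-v_{\boldsymbol\lambda(t)}\|\to0$ as $t\to+\infty$.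
   Context: $J$ nonexpansive means $\|J(x)-J(y)\|\le\|x-y\|$ for all $x,y\in X$. For $\lambda\in(0,1]$, the map $\Phi(\lambda,\cdot)$ is $(1-\lambda)$-Lipschitz and $v_\lambda$ denotes its unique fixed point: $v_\lambda=\Phi(\lambda,v_\lambda)$. The Cauchy problem has a unique solution on $[0,+\infty)$. *)

theory Defs
  imports "HOL-Analysis.Analysis"
begin

definition Phi :: "('a::real_normed_vector \<Rightarrow> 'a) \<Rightarrow> real \<Rightarrow> 'a \<Rightarrow> 'a" where
  "Phi J l x = l *\<^sub>R J (((1 - l) / l) *\<^sub>R x)"

(* Meaningful for nonexpansive J on a Banach space and l in (0,1]; see ex1_fixed_point_Phi. *)
definition fixp_Phi :: "('a::real_normed_vector \<Rightarrow> 'a) \<Rightarrow> real \<Rightarrow> 'a" where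
  "fixp_Phi J l = (THE x. x = Phi J l x)"

lemma dist_Phi_le:
  assumes J: "1-lipschitz_on UNIV J" and l: "0 < l" "l \<le> 1"
  shows "dist (Phi J l x) (Phi J l y) \<le> (1 - l) * dist x y"
proof -
  have scale: "dist (c *\<^sub>R a) (c *\<^sub>R b) = \<bar>c\<bar> * dist a b" for c and a b :: 'a
    by (metis dist_norm norm_scaleR scaleR_diff_right)
  define r where "r = (1 - l) / l"
  have r: "0 \<le> r" "l * r = 1 - l"
    using l by (auto simp: r_def)
  have "dist (Phi J l x) (Phi J l y) = l * dist (J (r *\<^sub>R x)) (J (r *\<^sub>R y))"
    using l by (simp add: Phi_def scale r_def)
  also have "\<dots> \<le> l * dist (r *\<^sub>R x) (r *\<^sub>R y)"
    using lipschitz_onD[OF J, of "r *\<^sub>R x" "r *\<^sub>R y"] l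
    by (intro mult_left_mono) auto
  also have "\<dots> = (l * r) * dist x y"
    using r(1) by (simp add: scale)
  finally show ?thesis
    by (simp add: r(2))
qed

lemma ex1_fixed_point_Phi:
  fixes J :: "'a::banach \<Rightarrow> 'a"
  assumes "1-lipschitz_on UNIV J" "0 < l" "l \<le> 1"
  shows "\<exists>!x. x = Phi J l x"
proof -
  have "\<exists>!x. Phi J l x = x"
    using assms by (intro banach_fix_type[where c = "1 - l"]) (auto intro: dist_Phi_le)
  then show ?thesis
    by metis
qed

lemma fixp_Phi_eq:
  fixes J :: "'a::banach \<Rightarrow> 'a"
  assumes "1-lipschitz_on UNIV J" "0 < l" "l \<le> 1"
  shows "fixp_Phi J l = Phi J l (fixp_Phi J l)"
  unfolding fixp_Phi_def by (rule theI'[OF ex1_fixed_point_Phi[OF assms]])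

(* At t = 0 the derivative is one-sided. *)
definition Cauchy_solution ::
    "('a::real_normed_vector \<Rightarrow> 'a) \<Rightarrow> (real \<Rightarrow> real) \<Rightarrow> 'a \<Rightarrow> (real \<Rightarrow> 'a) \<Rightarrow> bool" where
  "Cauchy_solution J lam u0 u \<longleftrightarrow>
     u 0 = u0 \<and>
     (\<forall>t\<ge>0. \<exists>u'. (u has_vector_derivative u') (at t within {0..}) \<and>
                u t + u' = Phi J (lam t) (u t))"

end

theory Submission
  imports Defs
begin

text \<open>
  Write \<open>v l\<close> for the fixed point of \<open>Phi J l\<close> and \<open>g t\<close> for the norm of \<open>u t - v (lam t)\<close>.
  The contraction property gives \<open>norm (v l) \<le> norm (J 0)\<close> and, together with the hypothesis on
  the dependence of \<open>Phi\<close> on its parameter, \<open>l * norm (v l - v m) \<le> K * \<bar>l - m\<bar>\<close> with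
  \<open>K = C + norm (J 0)\<close>.  Since the vector field \<open>Phi J l - id\<close> contracts towards \<open>v l\<close> at rate
  \<open>l\<close>, the function \<open>g\<close> satisfies, in the sense of one-sided difference quotients,
  \<open>g' \<le> - lam * g + K * \<bar>lam'\<bar> / lam\<close>.  From some time \<open>T\<close> on, \<open>\<bar>lam'\<bar> \<le> d * lam^2\<close> with a small
  \<open>d \<le> 1\<close>, so that \<open>g' \<le> - lam * (g - K * d)\<close>.

  It remains to see that the damping is strong enough. The function \<open>1 / lam\<close> has derivative
  at most 1, hence it is bounded by \<open>S t = 1 / lam T + (t - T)\<close>, and \<open>lam \<ge> 1 / S\<close>. Therefore
  \<open>B t = K * d + A / S t\<close> is a supersolution, and \<open>g \<le> B\<close> after \<open>T\<close> once \<open>A\<close> is chosen with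
  \<open>g T \<le> B T\<close>. As \<open>S\<close> tends to infinity, \<open>g\<close> is eventually at most about \<open>K * d\<close>.

  As \<open>g\<close> need not be differentiable, the comparison is made by looking at the least maximiser
  \<open>t\<close> of \<open>g - B\<close> on a compact interval and at difference quotients from the left. Expanding
  \<open>u\<close> backwards from \<open>t\<close> only involves the vector field at \<open>t\<close> itself.
\<close>

section \<open>A comparison principle\<close>

text \<open>A continuous function that, wherever it is positive, is dominated by one of its earlier values
  cannot become positive: consider the least point at which it attains its maximum.\<close>

lemma nonpos_if_dominated_by_earlier:
  fixes f :: "real \<Rightarrow> real"
  assumes cont: "continuous_on {a..b} f" and ab: "a \<le> b" and fa: "f a \<le> 0"
    and earlier: "\<And>t. a < t \<Longrightarrow> t \<le> b \<Longrightarrow> f t > 0 \<Longrightarrow> \<exists>s. a \<le> s \<and> s < t \<and> f t \<le> f s"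
  shows "f b \<le> 0"
proof (rule ccontr)
  assume "\<not> f b \<le> 0"
  obtain m where m: "m \<in> {a..b}" "\<And>y. y \<in> {a..b} \<Longrightarrow> f y \<le> f m"
    using continuous_attains_sup[OF compact_Icc _ cont] ab by auto
  define M where "M = {a..b} \<inter> f -` {f m}"
  have "closed M"
    unfolding M_def by (intro continuous_closed_preimage cont) auto
  then have "compact M"
    by (metis M_def compact_Icc compact_Int_closed inf.absorb_iff2 inf_le1)
  moreover have "m \<in> M" using m by (auto simp: M_def)
  ultimately obtain t where t: "t \<in> M" "\<And>s. s \<in> M \<Longrightarrow> t \<le> s"
    using compact_attains_inf[of M] by blast
  have ft: "f t = f m" "a \<le> t" "t \<le> b" using t by (auto simp: M_def)
  have pos: "f t > 0" using m(2)[of b] ab \<open>\<not> f b \<le> 0\<close> ft by auto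
  then have "a < t" using fa ft by (cases "a = t") auto
  then obtain s where s: "a \<le> s" "s < t" "f t \<le> f s" using earlier pos ft by blast
  then have "s \<in> M" using m(2)[of s] ft by (auto simp: M_def)
  with t s show False by fastforce
qed

section \<open>The fixed points\<close>

lemma norm_fixp_Phi_le:
  fixes J :: "'a::banach \<Rightarrow> 'a"
  assumes J: "1-lipschitz_on UNIV J" and l: "0 < l" "l \<le> 1"
  shows "norm (fixp_Phi J l) \<le> norm (J 0)"
proof -
  let ?v = "fixp_Phi J l"
  have "norm ?v = norm ((Phi J l ?v - Phi J l 0) + Phi J l 0)"
    using fixp_Phi_eq[OF J l] by simp
  also have "\<dots> \<le> (1 - l) * norm ?v + norm (Phi J l 0)"
    using dist_Phi_le[OF J l, of ?v 0] by (intro norm_triangle_le) (simp add: dist_norm)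
  also have "norm (Phi J l 0) = l * norm (J 0)"
    using l by (simp add: Phi_def)
  finally have "l * norm ?v \<le> l * norm (J 0)"
    by (simp add: algebra_simps)
  then show ?thesis using l by simp
qed

lemma dist_fixp_Phi_le:
  fixes J :: "'a::banach \<Rightarrow> 'a"
  assumes J: "1-lipschitz_on UNIV J" and l: "0 < l" "l \<le> 1" and m: "0 < m" "m \<le> 1"
    and Phi_lm: "\<And>x. norm (Phi J l x - Phi J m x) \<le> \<bar>l - m\<bar> * (C + norm x)"
  shows "norm (fixp_Phi J l - fixp_Phi J m) \<le> (C + norm (J 0)) * \<bar>l - m\<bar> / l"
proof -
  let ?v = "fixp_Phi J l" and ?w = "fixp_Phi J m"
  have "norm (?v - ?w) = norm ((Phi J l ?v - Phi J l ?w) + (Phi J l ?w - Phi J m ?w))"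
    using fixp_Phi_eq[OF J l] fixp_Phi_eq[OF J m] by simp
  also have "\<dots> \<le> (1 - l) * norm (?v - ?w) + \<bar>l - m\<bar> * (C + norm ?w)"
    using dist_Phi_le[OF J l, of ?v ?w] Phi_lm[of ?w]
    by (intro order.trans[OF norm_triangle_ineq] add_mono) (simp_all add: dist_norm)
  also have "\<bar>l - m\<bar> * (C + norm ?w) \<le> \<bar>l - m\<bar> * (C + norm (J 0))"
    using norm_fixp_Phi_le[OF J m] by (intro mult_left_mono) auto
  finally have "l * norm (?v - ?w) \<le> (C + norm (J 0)) * \<bar>l - m\<bar>"
    by (simp add: algebra_simps)
  then show ?thesis using l by (simp add: field_simps)
qed

lemma continuous_on_fixp_Phi:
  fixes J :: "'a::banach \<Rightarrow> 'a"
  assumes J: "1-lipschitz_on UNIV J"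
    and Phi_lam: "\<And>x l m. l \<in> {0<..1} \<Longrightarrow> m \<in> {0<..1} \<Longrightarrow>
          norm (Phi J l x - Phi J m x) \<le> \<bar>l - m\<bar> * (C + norm x)"
  shows "continuous_on {0<..1} (fixp_Phi J)"
  unfolding continuous_on_def
proof
  fix l :: real assume l: "l \<in> {0<..1}"
  have "((\<lambda>m. (C + norm (J 0)) * \<bar>l - m\<bar> / l) \<longlongrightarrow> (C + norm (J 0)) * \<bar>l - l\<bar> / l)
      (at l within {0<..1})"
    using l by (intro tendsto_intros) auto
  then have lim: "((\<lambda>m. (C + norm (J 0)) * \<bar>l - m\<bar> / l) \<longlongrightarrow> 0) (at l within {0<..1})"
    by simp
  have "((\<lambda>m. fixp_Phi J m - fixp_Phi J l) \<longlongrightarrow> 0) (at l within {0<..1})"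
  proof (rule Lim_null_comparison[OF _ lim])
    show "\<forall>\<^sub>F m in at l within {0<..1}.
        norm (fixp_Phi J m - fixp_Phi J l) \<le> (C + norm (J 0)) * \<bar>l - m\<bar> / l"
      unfolding eventually_at_filter
    proof (intro always_eventually allI impI)
      fix m :: real assume m: "m \<in> {0<..1}"
      show "norm (fixp_Phi J m - fixp_Phi J l) \<le> (C + norm (J 0)) * \<bar>l - m\<bar> / l"
        using dist_fixp_Phi_le[OF J, of l m C] Phi_lam[OF l m] l m
        by (simp add: norm_minus_commute)
    qed
  qed
  then show "(fixp_Phi J \<longlongrightarrow> fixp_Phi J l) (at l within {0<..1})"
    by (rule LIM_zero_cancel)
qed

text \<open>An explicit Euler step of length \<open>h\<close> backwards in time moves away from the fixed point at rate \<open>l\<close>.\<close>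

lemma backward_step_expands:
  fixes J :: "'a::banach \<Rightarrow> 'a"
  assumes J: "1-lipschitz_on UNIV J" and l: "0 < l" "l \<le> 1" and h: "0 \<le> h"
    and x': "x + x' = Phi J l x"
  shows "(1 + h * l) * norm (x - fixp_Phi J l) \<le> norm (x - h *\<^sub>R x' - fixp_Phi J l)"
proof -
  let ?v = "fixp_Phi J l"
  have v: "Phi J l ?v = ?v" using fixp_Phi_eq[OF J l] by simp
  have x'_eq: "x' = Phi J l x - x" using x' by (simp add: algebra_simps)
  have "(1 + h) *\<^sub>R (x - ?v) = (x - h *\<^sub>R x' - ?v) + h *\<^sub>R (Phi J l x - Phi J l ?v)"
    unfolding v x'_eq by (simp add: algebra_simps)
  then have "(1 + h) * norm (x - ?v) = norm ((x - h *\<^sub>R x' - ?v) + h *\<^sub>R (Phi J l x - Phi J l ?v))"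
    using h by (metis abs_of_nonneg add_nonneg_nonneg norm_scaleR zero_le_one)
  also have "\<dots> \<le> norm (x - h *\<^sub>R x' - ?v) + h * ((1 - l) * norm (x - ?v))"
    using dist_Phi_le[OF J l, of x ?v] h
    by (intro order.trans[OF norm_triangle_ineq] add_mono)
      (auto simp: dist_norm intro: mult_left_mono)
  finally show ?thesis by (simp add: algebra_simps)
qed

section \<open>Comparison along the trajectory\<close>

text \<open>The differential inequality \<open>g' \<le> - lam * g + K * \<bar>lam'\<bar> / lam\<close> for the distance \<open>g\<close> to the
  moving fixed point, in a form that allows for comparison with a differentiable function \<open>B\<close>:
  if \<open>B\<close> grows faster at \<open>t\<close> than the right-hand side, then \<open>g - B\<close> takes larger values just
  before \<open>t\<close>.\<close>

lemma distance_to_fixp_left: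
  fixes J :: "'a::banach \<Rightarrow> 'a" and u :: "real \<Rightarrow> 'a"
  assumes J: "1-lipschitz_on UNIV J"
    and Phi_lam: "\<And>x l m. l \<in> {0<..1} \<Longrightarrow> m \<in> {0<..1} \<Longrightarrow>
          norm (Phi J l x - Phi J m x) \<le> \<bar>l - m\<bar> * (C + norm x)"
    and lam_range: "\<And>s. a \<le> s \<Longrightarrow> lam s \<in> {0<..1}" and at: "a < t"
    and lam_deriv: "(lam has_real_derivative lam') (at t)"
    and u_deriv: "(u has_vector_derivative u') (at t)"
    and ode: "u t + u' = Phi J (lam t) (u t)"
    and B_deriv: "(B has_real_derivative B') (at t)"
    and fast: "(C + norm (J 0)) * \<bar>lam'\<bar> / lam t < lam t * norm (u t - fixp_Phi J (lam t)) + B'"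
  shows "\<exists>s. a \<le> s \<and> s < t \<and>
    norm (u t - fixp_Phi J (lam t)) - B t \<le> norm (u s - fixp_Phi J (lam s)) - B s"
proof -
  define v where "v s = fixp_Phi J (lam s)" for s
  define K where "K = C + norm (J 0)"
  define r where "r s = norm (u s - u t - (s - t) *\<^sub>R u') / norm (s - t)" for s
  define p where "p s = (lam s - lam t) / (s - t)" for s
  define q where "q s = (B s - B t) / (s - t)" for s
  have lt: "0 < lam t" "lam t \<le> 1" using lam_range[of t] at by auto
  have r_lim: "(r \<longlongrightarrow> 0) (at_left t)"
    using u_deriv unfolding has_vector_derivative_def has_derivative_at_within r_def
    by (intro filterlim_mono[OF _ order_refl at_le[of "{..<t}" UNIV]])
      (auto simp: divide_inverse mult.commute diff_diff_eq dest: tendsto_norm_zero)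
  have p_lim: "(p \<longlongrightarrow> lam') (at_left t)"
    using lam_deriv unfolding has_field_derivative_iff p_def
    by (intro filterlim_mono[OF _ order_refl at_le[of "{..<t}" UNIV]]) auto
  have q_lim: "(q \<longlongrightarrow> B') (at_left t)"
    using B_deriv unfolding has_field_derivative_iff q_def
    by (intro filterlim_mono[OF _ order_refl at_le[of "{..<t}" UNIV]]) auto
  have "((\<lambda>s. lam t * norm (u t - v t) - r s - K * \<bar>p s\<bar> / lam t + q s)
      \<longlongrightarrow> lam t * norm (u t - v t) - 0 - K * \<bar>lam'\<bar> / lam t + B') (at_left t)"
    using lt by (intro tendsto_intros r_lim p_lim q_lim) auto
  moreover have "0 < lam t * norm (u t - v t) - 0 - K * \<bar>lam'\<bar> / lam t + B'"
    using fast by (simp add: K_def v_def)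
  ultimately have "eventually (\<lambda>s. 0 < lam t * norm (u t - v t) - r s - K * \<bar>p s\<bar> / lam t + q s)
      (at_left t)"
    by (rule order_tendstoD)
  moreover have "eventually (\<lambda>s. s \<in> {a<..<t}) (at_left t)"
    using at by (rule eventually_at_left_real)
  ultimately have "eventually (\<lambda>s. s \<in> {a<..<t} \<and>
      0 < lam t * norm (u t - v t) - r s - K * \<bar>p s\<bar> / lam t + q s) (at_left t)"
    by eventually_elim auto
  then obtain s where s: "a < s" "s < t"
    and pos: "0 < lam t * norm (u t - v t) - r s - K * \<bar>p s\<bar> / lam t + q s"
    using eventually_happens'[OF trivial_limit_at_left_real[of t]] by fastforce
  define h where "h = t - s"
  have h: "h > 0" "s = t - h" using s by (auto simp: h_def)
  have v_le: "norm (v t - v s) \<le> h * (K * \<bar>p s\<bar> / lam t)"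
  proof -
    have "norm (v t - v s) \<le> K * \<bar>lam t - lam s\<bar> / lam t"
      unfolding v_def K_def using lam_range[of s] lt s
      by (intro dist_fixp_Phi_le[OF J lt] Phi_lam) auto
    also have "\<bar>lam t - lam s\<bar> = h * \<bar>p s\<bar>"
      using h by (simp add: p_def abs_minus_commute)
    finally show ?thesis by (simp add: mult_ac)
  qed
  have r_eq: "norm (u s - (u t - h *\<^sub>R u')) = h * r s"
  proof -
    have eq: "u s - (u t - h *\<^sub>R u') = u s - u t - (s - t) *\<^sub>R u'"
      using h(2) by simp
    show ?thesis unfolding eq using h by (simp add: r_def)
  qed
  have q_eq: "B t - B s = h * q s"
    using h by (simp add: q_def)
  have "(1 + h * lam t) * norm (u t - v t) \<le> norm (u t - h *\<^sub>R u' - v t)"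
    unfolding v_def using h by (intro backward_step_expands[OF J lt] ode) auto
  also have "\<dots> = norm ((u s - v s) - (u s - (u t - h *\<^sub>R u')) - (v t - v s))"
    by (simp add: algebra_simps)
  also have "\<dots> \<le> norm (u s - v s) + norm (u s - (u t - h *\<^sub>R u')) + norm (v t - v s)"
    by (intro order.trans[OF norm_triangle_ineq4] add_right_mono norm_triangle_ineq4)
  also have "\<dots> \<le> norm (u s - v s) + h * r s + h * (K * \<bar>p s\<bar> / lam t)"
    using v_le r_eq by simp
  finally have "norm (u t - v t) - B t
      + h * (lam t * norm (u t - v t) - r s - K * \<bar>p s\<bar> / lam t + q s)
      \<le> norm (u s - v s) - B s"
    using q_eq by (simp add: ring_distribs)
  moreover have "0 < h * (lam t * norm (u t - v t) - r s - K * \<bar>p s\<bar> / lam t + q s)"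
    using h pos by simp
  ultimately have "norm (u t - v t) - B t \<le> norm (u s - v s) - B s"
    by linarith
  then show ?thesis using s unfolding v_def by (intro exI[of _ s]) auto
qed

text \<open>Slow variation of \<open>lam\<close> prevents it from decaying faster than \<open>1 / t\<close>.\<close>

lemma inverse_lam_le:
  fixes lam lam' :: "real \<Rightarrow> real"
  assumes "T \<le> t" and pos: "\<And>s. T \<le> s \<Longrightarrow> 0 < lam s"
    and deriv: "\<And>s. T \<le> s \<Longrightarrow> (lam has_real_derivative lam' s) (at s)"
    and slow: "\<And>s. T \<le> s \<Longrightarrow> \<bar>lam' s\<bar> \<le> (lam s)\<^sup>2"
  shows "1 / lam t \<le> 1 / lam T + (t - T)"
proof -
  have "1 / lam t - t \<le> 1 / lam T - T"
  proof (rule DERIV_nonpos_imp_nonincreasing[OF \<open>T \<le> t\<close>])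
    fix s assume s: "T \<le> s"
    have "((\<lambda>s. 1 / lam s - s) has_real_derivative - lam' s / (lam s)\<^sup>2 - 1) (at s)"
      using pos[OF s] by (auto intro!: derivative_eq_intros deriv[OF s] simp: power2_eq_square)
    moreover have "- lam' s / (lam s)\<^sup>2 - 1 \<le> 0"
      using slow[OF s] pos[OF s] by (simp add: divide_simps)
    ultimately show "\<exists>y. ((\<lambda>s. 1 / lam s - s) has_real_derivative y) (at s) \<and> y \<le> 0"
      by blast
  qed
  then show ?thesis by simp
qed

text \<open>The bound \<open>g \<le> B\<close>. The coefficient \<open>A\<close> of the decaying part is \<open>g T * S T\<close>, where
  \<open>S T = 1 / lam T\<close>.\<close>

lemma distance_to_fixp_le:
  fixes J :: "'a::banach \<Rightarrow> 'a" and u :: "real \<Rightarrow> 'a"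
  assumes J: "1-lipschitz_on UNIV J" and C: "0 \<le> C"
    and Phi_lam: "\<And>x l m. l \<in> {0<..1} \<Longrightarrow> m \<in> {0<..1} \<Longrightarrow>
          norm (Phi J l x - Phi J m x) \<le> \<bar>l - m\<bar> * (C + norm x)"
    and lam_range: "\<And>s. T \<le> s \<Longrightarrow> lam s \<in> {0<..1}"
    and lam_deriv: "\<And>s. T \<le> s \<Longrightarrow> (lam has_real_derivative lam' s) (at s)"
    and u_deriv: "\<And>s. T \<le> s \<Longrightarrow> (u has_vector_derivative Phi J (lam s) (u s) - u s) (at s)"
    and d: "0 \<le> d" "d \<le> 1"
    and slow: "\<And>s. T \<le> s \<Longrightarrow> \<bar>lam' s\<bar> \<le> d * (lam s)\<^sup>2"
    and Tt: "T \<le> t"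
  shows "norm (u t - fixp_Phi J (lam t)) \<le> (C + norm (J 0)) * d
    + (norm (u T - fixp_Phi J (lam T)) / lam T) / (1 / lam T + (t - T))"
proof -
  define K where "K = C + norm (J 0)"
  define g where "g s = norm (u s - fixp_Phi J (lam s))" for s
  define S where "S s = 1 / lam T + (s - T)" for s
  define A where "A = g T / lam T"
  define B where "B s = K * d + A / S s" for s
  have K: "0 \<le> K" using C by (simp add: K_def)
  have lam_pos: "0 < lam s" if "T \<le> s" for s using lam_range[OF that] by simp
  have A: "0 \<le> A" using lam_pos[of T] by (simp add: A_def g_def)
  have S_ge: "1 / lam s \<le> S s" if "T \<le> s" for s
  proof -
    have "\<bar>lam' r\<bar> \<le> (lam r)\<^sup>2" if "T \<le> r" for r
      using slow[OF that] mult_right_mono[OF d(2), of "(lam r)\<^sup>2"] by simp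
    then show ?thesis
      unfolding S_def using that lam_pos lam_deriv by (intro inverse_lam_le) auto
  qed
  have S_pos: "0 < S s" if "T \<le> s" for s
    using lam_pos[of T] that by (simp add: S_def add_pos_nonneg)
  have B_deriv: "(B has_real_derivative - (A / (S s)\<^sup>2)) (at s)" if "T \<le> s" for s
    unfolding B_def using S_pos[OF that]
    by (auto intro!: derivative_eq_intros simp: S_def power2_eq_square)
  have "g t - B t \<le> 0"
  proof (rule nonpos_if_dominated_by_earlier[where f = "\<lambda>s. g s - B s", OF _ Tt])
    have "continuous_on {T..t} lam"
      by (intro continuous_at_imp_continuous_on ballI DERIV_isCont[OF lam_deriv]) auto
    then have "continuous_on {T..t} (\<lambda>s. fixp_Phi J (lam s))"
      using lam_range
      by (intro continuous_on_compose2[OF continuous_on_fixp_Phi[OF J Phi_lam]]) auto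
    moreover have "continuous_on {T..t} u"
      by (intro continuous_at_imp_continuous_on ballI
          has_vector_derivative_continuous[OF u_deriv]) auto
    moreover have "continuous_on {T..t} B"
      by (intro continuous_at_imp_continuous_on ballI DERIV_isCont[OF B_deriv]) auto
    ultimately show "continuous_on {T..t} (\<lambda>s. g s - B s)"
      unfolding g_def by (intro continuous_intros)
    show "g T - B T \<le> 0"
      using lam_pos[of T] K d by (simp add: B_def A_def S_def)
  next
    fix s assume s: "T < s" "s \<le> t" and pos: "0 < g s - B s"
    have sT: "T \<le> s" using s by simp
    note l = lam_pos[OF sT] and S0 = S_pos[OF sT]
    have "K * \<bar>lam' s\<bar> / lam s \<le> K * (d * (lam s)\<^sup>2) / lam s"
      using l K slow[OF sT] by (intro divide_right_mono mult_left_mono) auto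
    also have "\<dots> = lam s * (K * d)"
      using l by (simp add: power2_eq_square)
    finally have drift: "K * \<bar>lam' s\<bar> / lam s \<le> lam s * (K * d)" .
    have "1 \<le> lam s * S s"
      using S_ge[OF sT] l by (simp add: field_simps)
    then have "A / (S s)\<^sup>2 * 1 \<le> A / (S s)\<^sup>2 * (lam s * S s)"
      using A by (intro mult_left_mono) auto
    also have "\<dots> = lam s * (A / S s)"
      using S0 by (simp add: power2_eq_square)
    finally have decay: "A / (S s)\<^sup>2 \<le> lam s * (A / S s)" by simp
    have "0 < lam s * (g s - B s)" using l pos by simp
    then have "K * \<bar>lam' s\<bar> / lam s < lam s * g s + - (A / (S s)\<^sup>2)"
      using drift decay by (simp add: B_def algebra_simps)
    then show "\<exists>r. T \<le> r \<and> r < s \<and> g s - B s \<le> g r - B r"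
      unfolding g_def K_def
      by (intro distance_to_fixp_left[OF J Phi_lam lam_range s(1) lam_deriv[OF sT]
          u_deriv[OF sT] _ B_deriv[OF sT]]) auto
  qed
  then show ?thesis by (simp add: B_def A_def S_def g_def K_def)
qed

section \<open>Convergence\<close>

theorem corollary4p12:
  fixes J :: "'a::banach \<Rightarrow> 'a"
    and C :: real
    and lam lam' :: "real \<Rightarrow> real"
    and u :: "real \<Rightarrow> 'a"
    and u0 :: 'a
  assumes nonexpansive: "1-lipschitz_on UNIV J"
    and Phi_lam: "\<forall>x. \<forall>l\<in>{0<..1}. \<forall>m\<in>{0<..1}.
          norm (Phi J l x - Phi J m x) \<le> \<bar>l - m\<bar> * (C + norm x)"
    and lam_range: "\<forall>t\<ge>0. lam t \<in> {0<..1}"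
    and lam_deriv: "\<forall>t\<ge>0. (lam has_real_derivative lam' t) (at t within {0..})"
    and lam'_cont: "continuous_on {0..} lam'"
    and lam_slow: "((\<lambda>t. lam' t / (lam t)\<^sup>2) \<longlongrightarrow> 0) at_top"
    and solution: "Cauchy_solution J lam u0 u"
  shows "((\<lambda>t. norm (u t - fixp_Phi J (lam t))) \<longlongrightarrow> 0) at_top"
proof (rule tendstoI)
  fix e :: real assume e: "0 < e"
  have "0 \<le> \<bar>1 - 1 / 2\<bar> * (C + norm (0 :: 'a))"
    using Phi_lam[rule_format, of 1 "1 / 2" 0] by (intro order.trans[OF norm_ge_zero]) auto
  then have C: "0 \<le> C" by simp
  define K where "K = C + norm (J 0)"
  have K: "0 \<le> K" using C by (simp add: K_def)
  define d where "d = min 1 (e / (2 * (K + 1)))"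
  have d: "0 < d" "d \<le> 1" using e K by (auto simp: d_def)
  have "K * d \<le> K * (e / (2 * (K + 1)))"
    using K by (intro mult_left_mono) (auto simp: d_def)
  also have "\<dots> < e"
    using K e by (simp add: field_simps add_nonneg_pos)
  finally have Kd: "K * d < e" .
  have "eventually (\<lambda>t. \<bar>lam' t / (lam t)\<^sup>2\<bar> < d) at_top"
    using tendstoD[OF lam_slow d(1)] by simp
  then obtain N where N: "\<And>t. N \<le> t \<Longrightarrow> \<bar>lam' t / (lam t)\<^sup>2\<bar> < d"
    by (auto simp: eventually_at_top_linorder)
  \<comment> \<open>After a positive time, all one-sided derivatives are two-sided.\<close>
  define T where "T = max 1 N"
  have at_eq: "at t within {0..} = at t" if "T \<le> t" for t :: real
    using that by (intro at_within_interior) (auto simp: T_def)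
  have range: "lam t \<in> {0<..1}" if "T \<le> t" for t
    using lam_range that by (auto simp: T_def)
  have slow: "\<bar>lam' t\<bar> \<le> d * (lam t)\<^sup>2" if "T \<le> t" for t
    using N[of t] range[OF that] that by (simp add: T_def field_simps)
  have deriv: "(lam has_real_derivative lam' t) (at t)" if "T \<le> t" for t
    using lam_deriv[rule_format, of t] at_eq[OF that] that by (simp add: T_def)
  have u_deriv: "(u has_vector_derivative Phi J (lam t) (u t) - u t) (at t)" if "T \<le> t" for t
  proof -
    have "0 \<le> t" using that by (simp add: T_def)
    then obtain u' where u': "(u has_vector_derivative u') (at t within {0..})"
        and ode: "u t + u' = Phi J (lam t) (u t)"
      using solution unfolding Cauchy_solution_def by blast
    have "u' = Phi J (lam t) (u t) - u t" using ode by (simp add: algebra_simps)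
    then show ?thesis using u' at_eq[OF that] by simp
  qed
  define A where "A = norm (u T - fixp_Phi J (lam T)) / lam T"
  have bound: "norm (u t - fixp_Phi J (lam t)) \<le> K * d + A / (1 / lam T + (t - T))"
    if "T \<le> t" for t
    unfolding A_def K_def using Phi_lam that d
    by (intro distance_to_fixp_le[OF nonexpansive C _ range deriv u_deriv _ _ slow]) auto
  have "filterlim (\<lambda>t. (1 / lam T - T) + t) at_top at_top"
    by (rule filterlim_tendsto_add_at_top[OF tendsto_const filterlim_ident])
  then have "filterlim (\<lambda>t. 1 / lam T + (t - T)) at_infinity at_top"
    by (intro filterlim_at_top_imp_at_infinity) (simp add: algebra_simps)
  then have "((\<lambda>t. K * d + A / (1 / lam T + (t - T))) \<longlongrightarrow> K * d + 0) at_top"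
    by (rule tendsto_add[OF tendsto_const tendsto_divide_0[OF tendsto_const]])
  then have "eventually (\<lambda>t. K * d + A / (1 / lam T + (t - T)) < e) at_top"
    using Kd by (intro order_tendstoD(2)) auto
  then show "eventually (\<lambda>t. dist (norm (u t - fixp_Phi J (lam t))) 0 < e) at_top"
    using eventually_ge_at_top[of T] 
  proof eventually_elim
    case (elim t)
    then show ?case using bound[of t] by simp
  qed
qed

end
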